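(* Let $n \ge 1$ be an integer and let $\alpha = (\alpha_1,\dots,\alpha_n) \in \mathbb{C}^n$ with $|\alpha_k| > 1$ for $k = 1,\dots,n$. Let $\Phi : \mathbb{R} \to \mathbb{R}$ be any convex even function. For $\beta = (\beta_1,\dots,\beta_{n-1}) \in \mathbb{C}^{n-1}$ let $$P_n(\alpha,\beta,z) = \frac{\prod_{k=1}^{n-1}(z-\beta_k)}{\prod_{k=1}^{n}(z-\alpha_k)}, \qquad L_n(\alpha,\beta) = \int_{\mathbb{T}} \Phi\big(|P_n(\alpha,\beta,z)|\big)\, |dz| .$$ Then the minimum of $L_n(\alpha,\beta)$ over $\beta \in \mathbb{C}^{n-1}$ is attained, and $$\min_{\beta \in \mathbb{C}^{n-1}} L_n(\alpha,\beta) = \int_{\mathbb{T}} \Phi\left( \frac{1}{\left| z - \prod_{k=1}^n |\alpha_k| \right|} \right) |dz| .$$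
   Context: $\mathbb{T} = \{z \in \mathbb{C} : |z| = 1\}$ is the unit circle and $|dz|$ denotes arc length measure on $\mathbb{T}$. Empty products equal $1$. The $\alpha_k$ are not required to be distinct. *)

theory Defs
  imports "HOL-Analysis.Analysis"
begin

text \<open>Arc length measure \<open>|dz|\<close> on the unit circle: the image of Lebesgue measure on a full
  period under the unit-speed parametrization \<open>cis\<close>.\<close>

definition arc_length_measure :: "complex measure" where
  "arc_length_measure =
     distr (restrict_space lborel {0..<2 * pi}) (restrict_space borel (sphere 0 1)) cis"

text \<open>Elements of \<open>\<complex>\<^sup>n\<close> and \<open>\<complex>\<^sup>n\<^sup>-\<^sup>1\<close> are functions on \<open>nat\<close>, of which only the values at \<open>1..n\<close> and
  \<open>1..n-1\<close> (an empty range if \<open>n = 1\<close>) are used.\<close>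

definition Pfun :: "nat \<Rightarrow> (nat \<Rightarrow> complex) \<Rightarrow> (nat \<Rightarrow> complex) \<Rightarrow> complex \<Rightarrow> complex" where
  "Pfun n \<alpha> \<beta> z = (\<Prod>k=1..n-1. z - \<beta> k) / (\<Prod>k=1..n. z - \<alpha> k)"

definition Lfun :: "(real \<Rightarrow> real) \<Rightarrow> nat \<Rightarrow> (nat \<Rightarrow> complex) \<Rightarrow> (nat \<Rightarrow> complex) \<Rightarrow> real" where
  "Lfun \<Phi> n \<alpha> \<beta> = (LINT z|arc_length_measure. \<Phi> (norm (Pfun n \<alpha> \<beta> z)))"

end

theory Submission
  imports Defs "HOL-Complex_Analysis.Complex_Analysis"
    "HOL-Computational_Algebra.Fundamental_Theorem_Algebra"
begin

text \<open>
  Put \<open>A(z) = \<Prod>(z - \<alpha>\<^sub>k)\<close>, \<open>A\<^sup>*(z) = \<Prod>(1 - cnj \<alpha>\<^sub>k z)\<close>, \<open>c = - \<Prod>(- \<alpha>\<^sub>k)\<close> and \<open>a = |c|\<close>. The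
  polynomial \<open>Q\<close> with \<open>(1 - a\<^sup>2) z Q = A + c A\<^sup>*\<close> is monic of degree \<open>n - 1\<close> and has all its zeros
  in the open unit disc, and \<open>A = z Q - c Q\<^sup>*\<close>. Hence \<open>|Q / A| = 1 / |\<phi> - a|\<close> on the unit circle for
  the finite Blaschke product \<open>\<phi> = u z Q / Q\<^sup>*\<close>, where \<open>u = cnj c / a\<close>. As \<open>\<phi>(0) = 0\<close>, it preserves
  arc length, so \<open>Q\<close> attains the claimed value.

  Let \<open>R\<close> be another monic polynomial of degree \<open>n - 1\<close>. By the mean value property, \<open>Re (R / Q - 1)\<close>
  is orthogonal to all integer powers of \<open>\<phi>\<close>, hence to every continuous function of \<open>Re \<phi>\<close>, in
  particular to functions of \<open>|Q / A|\<close>. Since \<open>|R / A| \<ge> |Q / A| (1 + Re (R / Q - 1))\<close>, a supporting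
  line of the nondecreasing convex function \<open>\<Phi>\<close> on \<open>[0, \<infinity>)\<close> at \<open>|Q / A|\<close> gives the lower bound. The
  slope of the supporting line need not depend continuously on the point; secants of length \<open>h\<close> are
  used instead, and \<open>h\<close> tends to \<open>0\<close>.
\<close>

section \<open>Integration against arc length on the unit circle\<close>

lemma space_arc_length_measure [simp]: "space arc_length_measure = sphere 0 1"
  by (simp add: arc_length_measure_def space_restrict_space)

lemma cis_measurable_arc:
  "cis \<in> measurable (restrict_space lborel {0..<2 * pi}) (restrict_space borel (sphere 0 1))"
proof (rule measurable_restrict_space2)
  have "cis \<in> borel_measurable borel"
    by (intro borel_measurable_continuous_onI continuous_intros)
  then show "cis \<in> borel_measurable (restrict_space lborel {0..<2 * pi})"
    by (simp add: measurable_restrict_space1)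
qed auto

lemma finite_measure_arc_length: "finite_measure arc_length_measure"
proof -
  have "finite_measure (restrict_space lborel {0..<2 * pi :: real})"
    by (rule finite_measureI) (simp add: space_restrict_space emeasure_restrict_space)
  then show ?thesis
    unfolding arc_length_measure_def
    by (rule finite_measure.finite_measure_distr[OF _ cis_measurable_arc])
qed

lemma integrable_arc_length:
  fixes f :: "complex \<Rightarrow> 'b::{banach, second_countable_topology}"
  assumes "continuous_on (sphere 0 1) f"
  shows "integrable arc_length_measure f"
proof -
  interpret finite_measure arc_length_measure
    by (rule finite_measure_arc_length)
  obtain B where B: "\<And>z. z \<in> sphere 0 1 \<Longrightarrow> norm (f z) \<le> B"
    using compact_imp_bounded[OF compact_continuous_image[OF assms compact_sphere]]
    unfolding bounded_iff by blast
  show ?thesis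
  proof (rule integrable_const_bound)
    show "AE z in arc_length_measure. norm (f z) \<le> B"
      using B by (intro AE_I2) simp
    have "f \<in> borel_measurable (restrict_space borel (sphere 0 1))"
      by (rule borel_measurable_continuous_on_restrict[OF assms])
    then show "f \<in> borel_measurable arc_length_measure"
      by (simp add: arc_length_measure_def)
  qed
qed

text \<open>Link to the gauge integral over the closed interval \<open>{0..2 * pi}\<close>, in which
  contour integrals are expressed. The half-open period of the measure differs from it by one point
  only.\<close>

lemma has_integral_cis_arc_length:
  fixes f :: "complex \<Rightarrow> 'b::euclidean_space"
  assumes "continuous_on (sphere 0 1) f"
  shows "((\<lambda>t. f (cis t)) has_integral (LINT z|arc_length_measure. f z)) {0..2 * pi}"
proof -
  have meas: "f \<in> borel_measurable (restrict_space borel (sphere 0 1))"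
    by (rule borel_measurable_continuous_on_restrict[OF assms])
  have int: "integrable (restrict_space lborel {0..<2 * pi}) (\<lambda>t. f (cis t))"
    using integrable_arc_length[OF assms]
    unfolding arc_length_measure_def by (simp add: integrable_distr_eq[OF cis_measurable_arc meas])
  have *: "set_integrable lborel {0..<2 * pi} (\<lambda>t. f (cis t))"
    using int by (simp add: integrable_restrict_space set_integrable_def)
  have "(LINT z|arc_length_measure. f z) = (LINT t:{0..<2 * pi}|lborel. f (cis t))"
    unfolding arc_length_measure_def
    by (simp add: integral_distr[OF cis_measurable_arc meas] integral_restrict_space
        set_lebesgue_integral_def)
  also have "\<dots> = integral {0..<2 * pi} (\<lambda>t. f (cis t))"
    by (rule set_borel_integral_eq_integral(2)[OF *])
  finally have "((\<lambda>t. f (cis t)) has_integral (LINT z|arc_length_measure. f z)) {0..<2 * pi}"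
    using set_borel_integral_eq_integral(1)[OF *] by (simp add: has_integral_integrable_integral)
  moreover have "{0..<2 * pi} - {0..2 * pi} \<union> ({0..2 * pi} - {0..<2 * pi}) \<subseteq> {2 * pi}"
    by auto
  ultimately show ?thesis
    by (subst (asm) has_integral_spike_set_eq[of _ "{0..2 * pi}"])
      (auto intro: negligible_subset[of "{2 * pi}"])
qed

text \<open>Mean value property: on the circle \<open>dz = \<i> z |dz|\<close>, so up to the factor
  \<open>\<i>\<close> the integral is the contour integral of \<open>f z / z\<close>, which Cauchy's
  formula evaluates at 0.\<close>

lemma integral_arc_length_holomorphic:
  assumes "f holomorphic_on cball 0 1"
  shows "(LINT z|arc_length_measure. f z) = 2 * of_real pi * f 0"
proof -
  have "((\<lambda>u. f u / (u - 0)) has_contour_integral (2 * of_real pi * \<i> * f 0)) (circlepath 0 1)"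
    by (rule Cauchy_integral_circlepath_simple[OF assms]) simp
  then have "((\<lambda>t. \<i> * f (cis t)) has_integral (2 * of_real pi * \<i> * f 0)) {0..2 * pi}"
    unfolding circlepath_def by (subst (asm) has_contour_integral_part_circlepath_iff) (simp_all add: mult_ac)
  moreover have "continuous_on (sphere 0 1) f"
    using assms holomorphic_on_imp_continuous_on continuous_on_subset sphere_cball by blast
  then have "((\<lambda>t. \<i> * f (cis t)) has_integral (\<i> * (LINT z|arc_length_measure. f z))) {0..2 * pi}"
    by (intro has_integral_mult_right has_integral_cis_arc_length)
  ultimately have "\<i> * (LINT z|arc_length_measure. f z) = \<i> * (2 * of_real pi * f 0)"
    by (metis has_integral_unique mult.commute mult.left_commute)
  then show ?thesis by simp
qed

section \<open>Integrals of functions of \<open>Re \<phi>\<close> determined by the moments of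
  \<phi>\<close>

lemma Re_mult_Re_power:
  assumes "norm z = 1"
  shows "Re z * Re (z ^ Suc k) = (Re (z ^ Suc (Suc k)) + Re (z ^ k)) / 2"
proof -
  have "cnj z * z = 1"
    using complex_norm_square[of z] assms by (simp add: mult.commute)
  then have "(z + cnj z) * z ^ Suc k = z ^ Suc (Suc k) + z ^ k"
    by (simp add: algebra_simps)
  moreover have "z + cnj z = of_real (2 * Re z)"
    by (simp add: complex_add_cnj)
  ultimately have "2 * Re z * Re (z ^ Suc k) = Re (z ^ Suc (Suc k) + z ^ k)"
    by (metis Re_complex_of_real Im_complex_of_real times_complex.sel(1) diff_zero mult_zero_left)
  then show ?thesis by simp
qed

text \<open>The factor \<open>Re (\<phi> z ^ k)\<close> is there for the induction on
  \<open>i\<close>: the product-to-sum formula trades one power of \<open>Re \<phi>\<close> for a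
  shift of \<open>k\<close> by one up and down. At \<open>i = 0\<close> the real parts of the
  assumed moments remain.\<close>

lemma integral_Re_power_eqI:
  fixes \<phi> \<psi> :: "complex \<Rightarrow> complex" and g h :: "complex \<Rightarrow> real"
  assumes cont: "continuous_on (sphere 0 1) \<phi>" "continuous_on (sphere 0 1) g"
      "continuous_on (sphere 0 1) \<psi>" "continuous_on (sphere 0 1) h"
    and norm: "\<And>z. z \<in> sphere 0 1 \<Longrightarrow> norm (\<phi> z) = 1" "\<And>z. z \<in> sphere 0 1 \<Longrightarrow> norm (\<psi> z) = 1"
    and moments: "\<And>m. (LINT z|arc_length_measure. \<phi> z ^ m * of_real (g z)) =
                       (LINT z|arc_length_measure. \<psi> z ^ m * of_real (h z))"
  shows "(LINT z|arc_length_measure. Re (\<phi> z) ^ i * Re (\<phi> z ^ k) * g z) =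
         (LINT z|arc_length_measure. Re (\<psi> z) ^ i * Re (\<psi> z ^ k) * h z)"
proof (induction i arbitrary: k)
  case 0
  have "Re (LINT z|arc_length_measure. \<phi> z ^ k * of_real (g z)) =
        (LINT z|arc_length_measure. Re (\<phi> z ^ k) * g z)"
    by (subst integral_Re[symmetric]) (auto intro!: integrable_arc_length continuous_intros cont)
  moreover have "Re (LINT z|arc_length_measure. \<psi> z ^ k * of_real (h z)) =
        (LINT z|arc_length_measure. Re (\<psi> z ^ k) * h z)"
    by (subst integral_Re[symmetric]) (auto intro!: integrable_arc_length continuous_intros cont)
  ultimately show ?case
    using moments[of k] by simp
next
  case (Suc i)
  show ?case
  proof (cases k)
    case 0
    \<comment> \<open>For \<open>k = 0\<close> the second factor is 1, so one factor
      \<open>Re (\<phi> z)\<close> can be read as \<open>Re (\<phi> z ^ 1)\<close>.\<close>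
    then show ?thesis
      using Suc.IH[of 1] by (simp add: mult_ac)
  next
    case (Suc k')
    have step: "(LINT z|arc_length_measure. Re (\<theta> z) ^ Suc i * Re (\<theta> z ^ k) * f z) =
        ((LINT z|arc_length_measure. Re (\<theta> z) ^ i * Re (\<theta> z ^ Suc k) * f z) +
         (LINT z|arc_length_measure. Re (\<theta> z) ^ i * Re (\<theta> z ^ k') * f z)) / 2"
      if "continuous_on (sphere 0 1) \<theta>" "continuous_on (sphere 0 1) f"
        "\<And>z. z \<in> sphere 0 1 \<Longrightarrow> norm (\<theta> z) = 1" for \<theta> f
    proof -
      have "(LINT z|arc_length_measure. Re (\<theta> z) ^ Suc i * Re (\<theta> z ^ k) * f z) =
        (LINT z|arc_length_measure. (Re (\<theta> z) ^ i * Re (\<theta> z ^ Suc k) * f z +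
            Re (\<theta> z) ^ i * Re (\<theta> z ^ k') * f z) / 2)"
      proof (rule Bochner_Integration.integral_cong[OF refl])
        fix z assume "z \<in> space arc_length_measure"
        then have "Re (\<theta> z) * Re (\<theta> z ^ k) = (Re (\<theta> z ^ Suc k) + Re (\<theta> z ^ k')) / 2"
          unfolding Suc by (intro Re_mult_Re_power that) simp
        then have "Re (\<theta> z) ^ i * (Re (\<theta> z) * Re (\<theta> z ^ k)) * f z =
            Re (\<theta> z) ^ i * ((Re (\<theta> z ^ Suc k) + Re (\<theta> z ^ k')) / 2) * f z"
          by simp
        then show "Re (\<theta> z) ^ Suc i * Re (\<theta> z ^ k) * f z = (Re (\<theta> z) ^ i * Re (\<theta> z ^ Suc k) * f z +
            Re (\<theta> z) ^ i * Re (\<theta> z ^ k') * f z) / 2"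
          by (simp only: power_Suc algebra_simps add_divide_distrib times_divide_eq_right)
      qed
      then show ?thesis
        by (simp del: power_Suc) (subst Bochner_Integration.integral_add;
            auto intro!: integrable_arc_length continuous_intros that simp del: power_Suc)
    qed
    show ?thesis
      by (subst (1 2) step) (use cont norm Suc.IH in \<open>auto simp del: power_Suc\<close>)
  qed
qed

text \<open>Equal weighted moments give equal integrals of polynomials in the real part; uniform
  approximation by polynomials on \<open>{-1..1}\<close> extends this to continuous
  \<open>F\<close>. With \<open>h = 0\<close> it yields orthogonality, with \<open>g = h = 1\<close>
  and \<psi> the identity it compares \<phi> with arc length itself.\<close>

lemma integral_Re_eqI:
  fixes \<phi> \<psi> :: "complex \<Rightarrow> complex" and F g h :: "_ \<Rightarrow> real"
  assumes cont: "continuous_on (sphere 0 1) \<phi>" "continuous_on (sphere 0 1) g"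
      "continuous_on (sphere 0 1) \<psi>" "continuous_on (sphere 0 1) h"
    and norm: "\<And>z. z \<in> sphere 0 1 \<Longrightarrow> norm (\<phi> z) = 1" "\<And>z. z \<in> sphere 0 1 \<Longrightarrow> norm (\<psi> z) = 1"
    and moments: "\<And>m. (LINT z|arc_length_measure. \<phi> z ^ m * of_real (g z)) =
                       (LINT z|arc_length_measure. \<psi> z ^ m * of_real (h z))"
    and F: "continuous_on {-1..1} F"
  shows "(LINT z|arc_length_measure. F (Re (\<phi> z)) * g z) =
         (LINT z|arc_length_measure. F (Re (\<psi> z)) * h z)"
proof -
  let ?\<mu> = arc_length_measure
  have Re_range: "Re (\<phi> z) \<in> {-1..1}" "Re (\<psi> z) \<in> {-1..1}" if "z \<in> sphere 0 1" for z
    using norm[OF that] abs_Re_le_cmod[of "\<phi> z"] abs_Re_le_cmod[of "\<psi> z"] by auto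
  have contF: "continuous_on (sphere 0 1) (\<lambda>z. F (Re (\<phi> z)))"
      "continuous_on (sphere 0 1) (\<lambda>z. F (Re (\<psi> z)))"
    by (rule continuous_on_compose2[OF F], use cont Re_range in \<open>auto intro!: continuous_intros\<close>)+
  have approx: "\<bar>(LINT z|?\<mu>. F (Re (\<phi> z)) * g z) - (LINT z|?\<mu>. F (Re (\<psi> z)) * h z)\<bar>
      \<le> e * ((LINT z|?\<mu>. \<bar>g z\<bar>) + (LINT z|?\<mu>. \<bar>h z\<bar>))" if e: "e > 0" for e
  proof -
    obtain p where p: "real_polynomial_function p" "\<And>x. x \<in> {-1..1} \<Longrightarrow> \<bar>F x - p x\<bar> < e"
      using Stone_Weierstrass_real_polynomial_function[OF _ F e] by auto
    obtain a N where a: "p = (\<lambda>x. \<Sum>i\<le>N. a i * x ^ i)"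
      using p(1) unfolding real_polynomial_function_iff_sum by auto
    \<comment> \<open>Both facts are proved for generic \<theta> and \<open>f\<close> and then
      applied to both sides. The factor \<open>Re (\<theta> z ^ 0)\<close>, equal to 1, gives the
      integrals the form of the preceding lemma.\<close>
    have intp: "(LINT z|?\<mu>. p (Re (\<theta> z)) * f z) = (\<Sum>i\<le>N. a i * (LINT z|?\<mu>. Re (\<theta> z) ^ i * Re (\<theta> z ^ 0) * f z))"
      and error: "\<bar>(LINT z|?\<mu>. F (Re (\<theta> z)) * f z) - (LINT z|?\<mu>. p (Re (\<theta> z)) * f z)\<bar> \<le> e * (LINT z|?\<mu>. \<bar>f z\<bar>)"
      if cont': "continuous_on (sphere 0 1) \<theta>" "continuous_on (sphere 0 1) f"
        "continuous_on (sphere 0 1) (\<lambda>z. F (Re (\<theta> z)))"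
        and range': "\<And>z. z \<in> sphere 0 1 \<Longrightarrow> Re (\<theta> z) \<in> {-1..1}" for \<theta> f
    proof -
      show "(LINT z|?\<mu>. p (Re (\<theta> z)) * f z) = (\<Sum>i\<le>N. a i * (LINT z|?\<mu>. Re (\<theta> z) ^ i * Re (\<theta> z ^ 0) * f z))"
        unfolding a sum_distrib_right
        by (subst Bochner_Integration.integral_sum)
          (auto intro!: integrable_arc_length continuous_intros that simp: mult.assoc)
      have int: "integrable ?\<mu> (\<lambda>z. F (Re (\<theta> z)) * f z)" "integrable ?\<mu> (\<lambda>z. p (Re (\<theta> z)) * f z)"
          "integrable ?\<mu> (\<lambda>z. \<bar>f z\<bar>)"
        unfolding a by (auto intro!: integrable_arc_length continuous_intros cont')
      have "\<bar>(LINT z|?\<mu>. F (Re (\<theta> z)) * f z) - (LINT z|?\<mu>. p (Re (\<theta> z)) * f z)\<bar> =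
          \<bar>LINT z|?\<mu>. F (Re (\<theta> z)) * f z - p (Re (\<theta> z)) * f z\<bar>"
        using int by simp
      also have "\<dots> \<le> (LINT z|?\<mu>. \<bar>F (Re (\<theta> z)) * f z - p (Re (\<theta> z)) * f z\<bar>)"
        using integral_norm_bound[of ?\<mu> "\<lambda>z. F (Re (\<theta> z)) * f z - p (Re (\<theta> z)) * f z"] by simp
      also have "\<dots> \<le> (LINT z|?\<mu>. e * \<bar>f z\<bar>)"
      proof (rule integral_mono)
        fix z assume "z \<in> space ?\<mu>"
        then have "\<bar>F (Re (\<theta> z)) - p (Re (\<theta> z))\<bar> \<le> e"
          using p(2)[OF range'[of z]] by simp
        then show "\<bar>F (Re (\<theta> z)) * f z - p (Re (\<theta> z)) * f z\<bar> \<le> e * \<bar>f z\<bar>"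
          by (simp add: abs_mult mult_right_mono flip: left_diff_distrib)
      qed (use int in auto)
      finally show "\<bar>(LINT z|?\<mu>. F (Re (\<theta> z)) * f z) - (LINT z|?\<mu>. p (Re (\<theta> z)) * f z)\<bar> \<le> e * (LINT z|?\<mu>. \<bar>f z\<bar>)"
        by simp
    qed
    have "(LINT z|?\<mu>. p (Re (\<phi> z)) * g z) = (LINT z|?\<mu>. p (Re (\<psi> z)) * h z)"
      by (simp only: intp[OF cont(1,2) contF(1) Re_range(1)] intp[OF cont(3,4) contF(2) Re_range(2)]
          integral_Re_power_eqI[OF cont norm moments])
    then show ?thesis
      using error[OF cont(1,2) contF(1) Re_range(1)] error[OF cont(3,4) contF(2) Re_range(2)]
      by (simp add: algebra_simps)
  qed
  define C where "C = (LINT z|?\<mu>. \<bar>g z\<bar>) + (LINT z|?\<mu>. \<bar>h z\<bar>)"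
  have "C \<ge> 0" unfolding C_def by simp
  have "\<bar>(LINT z|?\<mu>. F (Re (\<phi> z)) * g z) - (LINT z|?\<mu>. F (Re (\<psi> z)) * h z)\<bar> \<le> 0"
  proof (rule field_le_epsilon)
    fix e :: real assume "e > 0"
    \<comment> \<open>The summand 1 keeps the denominator positive when
      \<open>C = 0\<close>.\<close>
    then have "e / (C + 1) * C \<le> e"
      using \<open>C \<ge> 0\<close> by (simp add: field_simps)
    then show "\<bar>(LINT z|?\<mu>. F (Re (\<phi> z)) * g z) - (LINT z|?\<mu>. F (Re (\<psi> z)) * h z)\<bar> \<le> 0 + e"
      using approx[of "e / (C + 1)"] \<open>e > 0\<close> \<open>C \<ge> 0\<close> unfolding C_def[symmetric] by simp
  qed
  then show ?thesis by simp
qed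

section \<open>Reflected products, monic polynomials and the extremal numerator\<close>

lemma prod_reflect_cnj:
  fixes b :: "'a \<Rightarrow> complex"
  assumes "norm z = 1"
  shows "(\<Prod>k\<in>S. 1 - cnj (b k) * z) = z ^ card S * cnj (\<Prod>k\<in>S. z - b k)"
proof (induction S rule: infinite_finite_induct)
  case (insert k S)
  have "z * cnj z = 1"
    using complex_norm_square[of z] assms by simp
  then have "1 - cnj (b k) * z = z * cnj (z - b k)"
    by (simp add: algebra_simps)
  then show ?case
    using insert by (simp only: prod.insert[OF insert.hyps] card_insert_disjoint power_Suc complex_cnj_mult)
      (simp add: mult_ac)
qed auto

text \<open>Factor by factor this gives \<open>|A| \<le> |A\<^sup>*|\<close> outside the open disc,
  the estimate that forces the zeros of the extremal numerator into the disc.\<close>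

lemma norm_diff_le_norm_reflect:
  assumes "norm a \<ge> 1" "norm z \<ge> 1"
  shows "norm (z - a) \<le> norm (1 - cnj a * z)"
proof -
  have "norm (1 - cnj a * z) ^ 2 - norm (z - a) ^ 2 = (norm a ^ 2 - 1) * (norm z ^ 2 - 1)"
    unfolding cmod_power2 by (simp add: algebra_simps power2_eq_square)
  also have "\<dots> \<ge> 0"
    using assms by simp
  finally have "norm (z - a) ^ 2 \<le> norm (1 - cnj a * z) ^ 2"
    by simp
  then show ?thesis
    by (rule power2_le_imp_le) simp
qed

lemma reflect_factor_nonzero:
  fixes b z :: complex
  assumes "norm b < 1" "norm z \<le> 1"
  shows "1 - cnj b * z \<noteq> 0"
proof
  assume "1 - cnj b * z = 0"
  then have "norm b * norm z = 1"
    by (metis complex_mod_cnj eq_iff_diff_eq_0 norm_mult norm_one)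
  moreover have "norm b * norm z \<le> norm b"
    using assms by (simp add: mult_left_le)
  ultimately show False using assms by simp
qed

lemma poly_prod_linear:
  "poly (\<Prod>k\<in>S. [:- b k, 1:]) z = (\<Prod>k\<in>S. z - b k)" for b :: "'a \<Rightarrow> 'b::idom"
  by (simp add: poly_prod)

lemma degree_prod_linear:
  "degree (\<Prod>k\<in>S. [:- b k, 1:]) = card S" for b :: "'a \<Rightarrow> 'b::idom"
  by (simp add: degree_prod_sum_eq)

lemma lead_coeff_prod_linear:
  "coeff (\<Prod>k\<in>S. [:- b k, 1:]) (card S) = 1" for b :: "'a \<Rightarrow> 'b::idom"
  using lead_coeff_prod[of "\<lambda>k. [:- b k, 1:]" S] by (simp add: degree_prod_linear)

text \<open>With the leading term split off, the difference of two such products is visibly a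
  combination of the \<open>z ^ j\<close> with \<open>j < m\<close>.\<close>

lemma prod_diff_eq_power_plus:
  fixes b :: "nat \<Rightarrow> 'a::idom"
  shows "\<exists>r. \<forall>z. (\<Prod>k=1..m. z - b k) = z ^ m + (\<Sum>j<m. r j * z ^ j)"
proof -
  define p where "p = (\<Prod>k=1..m. [:- b k, 1:])"
  have "degree p = m" "coeff p m = 1"
    using degree_prod_linear[of b "{1..m}"] lead_coeff_prod_linear[of b "{1..m}"] by (simp_all add: p_def)
  then have "poly p z = z ^ m + (\<Sum>j<m. coeff p j * z ^ j)" for z
    by (simp add: poly_altdef flip: lessThan_Suc_atMost)
  then show ?thesis
    unfolding p_def poly_prod_linear by blast
qed

lemma monic_complex_poly_factors:
  fixes q :: "complex poly"
  assumes "lead_coeff q = 1"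
  obtains b where "\<And>z. poly q z = (\<Prod>k=1..degree q. z - b k)"
proof -
  obtain r where r: "smult (lead_coeff q) (\<Prod>i<degree q. [:- r i, 1:]) = q"
    by (rule complex_poly_decompose')
  have "poly q z = (\<Prod>k=1..degree q. z - r (k - 1))" for z
  proof -
    have "poly q z = (\<Prod>i<degree q. z - r i)"
      using arg_cong[OF r, of "\<lambda>p. poly p z"] assms by (simp add: poly_prod_linear)
    also have "\<dots> = (\<Prod>k=1..degree q. z - r (k - 1))"
      by (rule prod.reindex_bij_witness[of _ "\<lambda>k. k - 1" Suc]) auto
    finally show ?thesis .
  qed
  then show thesis by (rule that)
qed

text \<open>The value of \<open>c\<close> makes the right-hand side vanish at 0, so that
  \<open>z\<close> can be divided out. Its leading coefficient is \<open>1 - c * cnj c\<close>,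
  which is nonzero because \<open>norm c > 1\<close>; dividing by it leaves a monic polynomial of
  degree \<open>n - 1\<close>, and the \<beta> are its roots.\<close>

lemma extremal_numerator_exists:
  fixes \<alpha> :: "nat \<Rightarrow> complex"
  assumes n: "n \<ge> 1" and \<alpha>: "\<And>k. k \<in> {1..n} \<Longrightarrow> norm (\<alpha> k) > 1"
  defines "c \<equiv> - (\<Prod>k=1..n. - \<alpha> k)"
  obtains \<beta> where "\<And>k. k \<in> {1..n-1} \<Longrightarrow> norm (\<beta> k) < 1"
    and "\<And>z. z * (\<Prod>k=1..n-1. z - \<beta> k) * of_real (1 - norm c ^ 2) =
             (\<Prod>k=1..n. z - \<alpha> k) + c * (\<Prod>k=1..n. 1 - cnj (\<alpha> k) * z)"
proof -
  have c: "norm c > 1"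
  proof -
    have "1 < (\<Prod>k=1..n. norm (\<alpha> k))"
      using n \<alpha> by (intro less_1_prod) auto
    then show ?thesis by (simp add: c_def flip: prod_norm)
  qed
  have c2: "1 - norm c ^ 2 \<noteq> 0"
    using c by (simp add: power2_eq_1_iff)
  define K where "K = complex_of_real (1 - norm c ^ 2)"
  have K: "K \<noteq> 0" "K = 1 - c * cnj c"
    using c2 unfolding K_def of_real_eq_0_iff by (simp_all flip: complex_norm_square)
  define p where "p = (\<Prod>k=1..n. [:- \<alpha> k, 1:]) + smult c (\<Prod>k=1..n. [:1, - cnj (\<alpha> k):])"
  have poly_p: "poly p z = (\<Prod>k=1..n. z - \<alpha> k) + c * (\<Prod>k=1..n. 1 - cnj (\<alpha> k) * z)" for z
    by (simp add: p_def poly_prod mult.commute)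
  have \<alpha>0: "\<alpha> k \<noteq> 0" if "k \<in> {1..n}" for k
    using \<alpha>[OF that] by auto
  have deg2: "degree (\<Prod>k=1..n. [:1, - cnj (\<alpha> k):]) = n"
  proof -
    have "degree (\<Prod>k=1..n. [:1, - cnj (\<alpha> k):]) = (\<Sum>k=1..n. degree [:1, - cnj (\<alpha> k):])"
      by (rule degree_prod_sum_eq) auto
    also have "\<dots> = (\<Sum>k=1..n. 1)"
      using \<alpha>0 by (intro sum.cong refl) simp
    finally show ?thesis by simp
  qed
  have "coeff (\<Prod>k=1..n. [:1, - cnj (\<alpha> k):]) n = (\<Prod>k=1..n. - cnj (\<alpha> k))"
  proof -
    have "coeff (\<Prod>k=1..n. [:1, - cnj (\<alpha> k):]) n = (\<Prod>k=1..n. lead_coeff [:1, - cnj (\<alpha> k):])"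
      using lead_coeff_prod[of "\<lambda>k. [:1, - cnj (\<alpha> k):]" "{1..n}"] unfolding deg2 .
    also have "\<dots> = (\<Prod>k=1..n. - cnj (\<alpha> k))"
      using \<alpha>0 by (intro prod.cong refl) simp
    finally show ?thesis .
  qed
  also have "\<dots> = - cnj c"
    by (simp add: c_def)
  finally have coeff_n: "coeff p n = K"
    using lead_coeff_prod_linear[of \<alpha> "{1..n}"] unfolding p_def K(2) coeff_add coeff_smult by simp
  have deg_p: "degree p = n"
  proof (rule antisym)
    show "degree p \<le> n"
      unfolding p_def using deg2 degree_prod_linear[of \<alpha> "{1..n}"]
      by (intro degree_add_le) (auto intro: order.trans[OF degree_smult_le])
    show "n \<le> degree p"
      using coeff_n K by (intro le_degree) simp
  qed
  have "poly p 0 = 0"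
    by (simp add: poly_p c_def)
  then obtain q where q: "p = pCons 0 q"
    by (cases p rule: pCons_cases) auto
  have "q \<noteq> 0"
    using q deg_p n by auto
  then have deg_q: "degree q = n - 1"
    using deg_p q by simp
  define q' where "q' = smult (inverse K) q"
  have deg_q': "degree q' = n - 1"
    using K deg_q by (simp add: q'_def)
  have "coeff q (n - 1) = K"
    using coeff_n q n by (simp add: coeff_pCons split: nat.splits)
  then have "lead_coeff q' = 1"
    using K deg_q by (simp add: q'_def)
  then obtain \<beta> where \<beta>: "\<And>z. poly q' z = (\<Prod>k=1..n-1. z - \<beta> k)"
    using monic_complex_poly_factors[of q'] unfolding deg_q' by blast
  have eq: "z * (\<Prod>k=1..n-1. z - \<beta> k) * K = poly p z" for z
  proof -
    have "(\<Prod>k=1..n-1. z - \<beta> k) * K = poly q z"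
      using K(1) \<beta>[of z, symmetric] by (simp add: q'_def)
    then show ?thesis
      by (simp add: q mult.assoc)
  qed
  have "norm (\<beta> k) < 1" if k: "k \<in> {1..n-1}" for k
  proof (rule ccontr)
    assume "\<not> norm (\<beta> k) < 1"
    then have b: "norm (\<beta> k) \<ge> 1" by simp
    \<comment> \<open>At a root of modulus at least 1 the identity gives
      \<open>|A| = |c| |B|\<close>. Since \<open>|c| > 1\<close> and \<open>B \<noteq> 0\<close>,
      this contradicts \<open>|A| \<le> |B|\<close>.\<close>
    define A B where "A = (\<Prod>i=1..n. \<beta> k - \<alpha> i)" and "B = (\<Prod>i=1..n. 1 - cnj (\<alpha> i) * \<beta> k)"
    have "(\<Prod>i=1..n-1. \<beta> k - \<beta> i) = 0"
      using k by (intro prod_zero) auto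
    then have "A + c * B = 0"
      using eq[of "\<beta> k"] unfolding poly_p A_def[symmetric] B_def[symmetric]
      by (metis mult_zero_left mult_zero_right)
    then have "norm A = norm c * norm B"
      by (metis add_eq_0_iff2 norm_minus_cancel norm_mult)
    moreover have "norm A \<le> norm B"
      unfolding A_def B_def prod_norm[symmetric]
    proof (intro prod_mono conjI norm_ge_zero)
      fix i assume "i \<in> {1..n}"
      then show "norm (\<beta> k - \<alpha> i) \<le> norm (1 - cnj (\<alpha> i) * \<beta> k)"
        using \<alpha>[of i] b by (intro norm_diff_le_norm_reflect) auto
    qed
    moreover have "B \<noteq> 0"
    proof -
      have "1 - cnj (\<alpha> i) * \<beta> k \<noteq> 0" if "i \<in> {1..n}" for i
      proof
        assume "1 - cnj (\<alpha> i) * \<beta> k = 0"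
        then have "norm (\<alpha> i) * norm (\<beta> k) = 1"
          by (metis complex_mod_cnj eq_iff_diff_eq_0 norm_mult norm_one)
        moreover have "norm (\<alpha> i) * norm (\<beta> k) \<ge> norm (\<alpha> i)"
          using b by (simp add: mult_le_cancel_left1)
        ultimately show False using \<alpha>[OF that] by simp
      qed
      then show ?thesis by (simp add: B_def)
    qed
    ultimately show False
      using c by (simp add: mult_le_cancel_right1)
  qed
  then show thesis
    using eq unfolding poly_p K_def by (rule that)
qed

section \<open>A finite Blaschke product and its orthogonality relations\<close>

locale blaschke =
  fixes u :: complex and m :: nat and \<beta> :: "nat \<Rightarrow> complex"
  assumes norm_u: "norm u = 1" and norm_\<beta>: "\<And>k. k \<in> {1..m} \<Longrightarrow> norm (\<beta> k) < 1"
begin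

definition Q where "Q z = (\<Prod>k=1..m. z - \<beta> k)"

text \<open>The conjugate reciprocal polynomial \<open>z ^ m * cnj (Q (1 / cnj z))\<close>, written
  as a product so that it makes sense at 0 too.\<close>

definition Qstar where "Qstar z = (\<Prod>k=1..m. 1 - cnj (\<beta> k) * z)"

definition \<phi> where "\<phi> z = u * z * Q z / Qstar z"

lemma Qstar_nonzero: "norm z \<le> 1 \<Longrightarrow> Qstar z \<noteq> 0"
  using reflect_factor_nonzero norm_\<beta> by (auto simp: Qstar_def)

lemma Q_nonzero: "norm z = 1 \<Longrightarrow> Q z \<noteq> 0"
  using norm_\<beta> by (fastforce simp: Q_def)

lemma Qstar_eq: "norm z = 1 \<Longrightarrow> Qstar z = z ^ m * cnj (Q z)"
  using prod_reflect_cnj[of z \<beta> "{1..m}"] by (simp add: Qstar_def Q_def)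

lemma norm_Qstar: "norm z = 1 \<Longrightarrow> norm (Qstar z) = norm (Q z)"
  by (simp add: Qstar_eq norm_mult norm_power)

lemma \<phi>_mult_Qstar: "norm z \<le> 1 \<Longrightarrow> \<phi> z * Qstar z = u * z * Q z"
  using Qstar_nonzero[of z] by (simp add: \<phi>_def)

lemma norm_\<phi>: "norm z = 1 \<Longrightarrow> norm (\<phi> z) = 1"
  using Q_nonzero[of z] by (simp add: \<phi>_def norm_Qstar norm_divide norm_mult norm_u)

lemma holomorphic_Q [holomorphic_intros]: "Q holomorphic_on S"
  unfolding Q_def by (intro holomorphic_intros)

lemma holomorphic_Qstar [holomorphic_intros]: "Qstar holomorphic_on S"
  unfolding Qstar_def by (intro holomorphic_intros)

lemma holomorphic_\<phi>: "\<phi> holomorphic_on cball 0 1"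
  unfolding \<phi>_def using Qstar_nonzero by (intro holomorphic_intros) auto

lemma continuous_\<phi>: "continuous_on (sphere 0 1) \<phi>"
  using holomorphic_\<phi> holomorphic_on_imp_continuous_on continuous_on_subset sphere_cball by blast

lemma continuous_Q: "continuous_on S Q"
  by (rule holomorphic_on_imp_continuous_on[OF holomorphic_Q])

lemma \<phi>_0: "\<phi> 0 = 0"
  by (simp add: \<phi>_def)

text \<open>Since \<phi> fixes 0, the mean value property gives both integrals the value
  \<open>2 * pi * 0 ^ l\<close>.\<close>

lemma integral_\<phi>_power:
  "(LINT z|arc_length_measure. \<phi> z ^ l) = (LINT z|arc_length_measure. z ^ l)"
  by (subst (1 2) integral_arc_length_holomorphic)
    (auto intro!: holomorphic_intros holomorphic_\<phi> simp: \<phi>_0 power_0_left)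

text \<open>On the circle \<open>cnj (z ^ j / Q z)\<close> equals
  \<open>z ^ (m - j) / Qstar z\<close>, which is holomorphic on the closed disc and vanishes at 0
  because \<open>j < m\<close>.\<close>

lemma integral_cnj_monomial:
  assumes "j < m"
  shows "(LINT z|arc_length_measure. \<phi> z ^ l * cnj (z ^ j / Q z)) = 0"
proof -
  have "(LINT z|arc_length_measure. \<phi> z ^ l * cnj (z ^ j / Q z)) =
        (LINT z|arc_length_measure. \<phi> z ^ l * (z ^ (m - j) / Qstar z))"
  proof (rule Bochner_Integration.integral_cong[OF refl])
    fix z assume "z \<in> space arc_length_measure"
    then have z: "norm z = 1" by simp
    then have "z * cnj z = 1"
      using complex_norm_square[of z] by simp
    then have "z ^ j * cnj z ^ j = 1"
      by (metis power_mult_distrib power_one)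
    moreover have "z ^ m = z ^ (m - j) * z ^ j"
      using assms by (simp flip: power_add)
    moreover have "z \<noteq> 0" "cnj (Q z) \<noteq> 0"
      using z Q_nonzero by auto
    ultimately show "\<phi> z ^ l * cnj (z ^ j / Q z) = \<phi> z ^ l * (z ^ (m - j) / Qstar z)"
      using z by (simp add: Qstar_eq divide_simps mult_ac)
  qed
  also have "\<dots> = 0"
    using assms Qstar_nonzero
    by (subst integral_arc_length_holomorphic)
      (auto intro!: holomorphic_intros holomorphic_\<phi> simp: \<phi>_0 power_0_left)
  finally show ?thesis .
qed

text \<open>The zeros of \<open>Q\<close> lie inside the disc, so the mean value property does not
  apply directly. If \<open>l > 0\<close>, one factor \<phi> cancels \<open>Q\<close> and
  contributes a zero at 0; if \<open>l = 0\<close>, the integral is the conjugate of one already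
  known to vanish.\<close>

lemma integral_monomial:
  assumes "j < m"
  shows "(LINT z|arc_length_measure. \<phi> z ^ l * (z ^ j / Q z)) = 0"
proof (cases l)
  case 0
  have "cnj (LINT z|arc_length_measure. z ^ j / Q z) = (LINT z|arc_length_measure. cnj (z ^ j / Q z))"
    by (rule Bochner_Integration.integral_cnj[symmetric])
  then show ?thesis
    using integral_cnj_monomial[OF assms, of 0] 0 by simp
next
  case (Suc l')
  have "(LINT z|arc_length_measure. \<phi> z ^ l * (z ^ j / Q z)) =
        (LINT z|arc_length_measure. \<phi> z ^ l' * (u * z ^ Suc j / Qstar z))"
    by (rule Bochner_Integration.integral_cong[OF refl])
      (auto simp: Suc \<phi>_def Q_nonzero)
  also have "\<dots> = 0"
    using Qstar_nonzero
    by (subst integral_arc_length_holomorphic)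
      (auto intro!: holomorphic_intros holomorphic_\<phi>)
  finally show ?thesis .
qed

text \<open>Both numerators are monic of degree \<open>m\<close>, so the quotient minus 1 is a
  combination of \<open>z ^ j / Q z\<close> with \<open>j < m\<close>. Writing
  \<open>Re w = (w + cnj w) / 2\<close> reduces the claim to the two monomial integrals.\<close>

lemma integral_Re_quotient:
  "(LINT z|arc_length_measure. \<phi> z ^ l * of_real (Re ((\<Prod>k=1..m. z - \<gamma> k) / Q z - 1))) = 0"
proof -
  obtain r where r: "\<And>z. (\<Prod>k=1..m. z - \<gamma> k) = z ^ m + (\<Sum>j<m. r j * z ^ j)"
    using prod_diff_eq_power_plus[of \<gamma> m] by blast
  obtain s where s: "\<And>z. Q z = z ^ m + (\<Sum>j<m. s j * z ^ j)"
    using prod_diff_eq_power_plus[of \<beta> m] unfolding Q_def by blast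
  define d where "d j = r j - s j" for j
  have "(LINT z|arc_length_measure. \<phi> z ^ l * of_real (Re ((\<Prod>k=1..m. z - \<gamma> k) / Q z - 1))) =
        (LINT z|arc_length_measure. (\<Sum>j<m. d j / 2 * (\<phi> z ^ l * (z ^ j / Q z)) +
            cnj (d j) / 2 * (\<phi> z ^ l * cnj (z ^ j / Q z))))"
  proof (rule Bochner_Integration.integral_cong[OF refl])
    fix z assume "z \<in> space arc_length_measure"
    then have "Q z \<noteq> 0" using Q_nonzero by simp
    then have *: "(\<Prod>k=1..m. z - \<gamma> k) / Q z - 1 = ((\<Prod>k=1..m. z - \<gamma> k) - Q z) / Q z"
      by (simp add: diff_divide_distrib)
    have "\<dots> = (\<Sum>j<m. d j * z ^ j) / Q z"
      unfolding r by (subst s) (simp add: d_def sum_subtractf left_diff_distrib)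
    also have "\<dots> = (\<Sum>j<m. d j * (z ^ j / Q z))"
      by (simp add: sum_divide_distrib)
    finally have **: "(\<Prod>k=1..m. z - \<gamma> k) / Q z - 1 = (\<Sum>j<m. d j * (z ^ j / Q z))"
      using * by simp
    have "complex_of_real (Re w) = (w + cnj w) / 2" for w
      by (simp add: complex_add_cnj)
    then have "\<phi> z ^ l * of_real (Re (\<Sum>j<m. d j * (z ^ j / Q z))) =
        (\<Sum>j<m. \<phi> z ^ l * ((d j * (z ^ j / Q z) + cnj (d j * (z ^ j / Q z))) / 2))"
      by (simp only: cnj_sum sum.distrib[symmetric] sum_divide_distrib sum_distrib_left)
    also have "\<dots> = (\<Sum>j<m. d j / 2 * (\<phi> z ^ l * (z ^ j / Q z)) + cnj (d j) / 2 * (\<phi> z ^ l * cnj (z ^ j / Q z)))"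
      by (intro sum.cong refl) (simp add: algebra_simps add_divide_distrib)
    finally show "\<phi> z ^ l * of_real (Re ((\<Prod>k=1..m. z - \<gamma> k) / Q z - 1)) =
        (\<Sum>j<m. d j / 2 * (\<phi> z ^ l * (z ^ j / Q z)) + cnj (d j) / 2 * (\<phi> z ^ l * cnj (z ^ j / Q z)))"
      unfolding ** .
  qed
  also have "\<dots> = (\<Sum>j<m. d j / 2 * (LINT z|arc_length_measure. \<phi> z ^ l * (z ^ j / Q z)) +
            cnj (d j) / 2 * (LINT z|arc_length_measure. \<phi> z ^ l * cnj (z ^ j / Q z)))"
  proof -
    have int: "integrable arc_length_measure (\<lambda>z. \<phi> z ^ l * (z ^ j / Q z))"
      "integrable arc_length_measure (\<lambda>z. \<phi> z ^ l * cnj (z ^ j / Q z))" for j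
      using Q_nonzero
      by (auto intro!: integrable_arc_length continuous_intros continuous_\<phi> continuous_Q)
    show ?thesis
      by (subst Bochner_Integration.integral_sum)
        (use int in \<open>simp_all del: complex_cnj_divide complex_cnj_power times_divide_eq_left times_divide_eq_right\<close>)
  qed
  also have "\<dots> = 0"
    by (intro sum.neutral ballI) (simp only: lessThan_iff integral_monomial integral_cnj_monomial, simp)
  finally show ?thesis .
qed

lemma integral_Re_\<phi>_quotient:
  fixes F :: "real \<Rightarrow> real"
  assumes "continuous_on {-1..1} F"
  shows "(LINT z|arc_length_measure. F (Re (\<phi> z)) * Re ((\<Prod>k=1..m. z - \<gamma> k) / Q z - 1)) = 0"
proof -
  have "(LINT z|arc_length_measure. F (Re (\<phi> z)) * Re ((\<Prod>k=1..m. z - \<gamma> k) / Q z - 1)) =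
        (LINT z|arc_length_measure. F (Re (\<phi> z)) * 0)"
    using Q_nonzero assms
    by (intro integral_Re_eqI)
      (auto intro!: continuous_intros continuous_\<phi> continuous_Q simp: norm_\<phi> integral_Re_quotient[simplified])
  then show ?thesis by simp
qed

text \<open>The form in which the invariance of arc length under \<phi> is used: \<phi> and the
  identity have the same moments.\<close>

lemma integral_Re_\<phi>:
  fixes F :: "real \<Rightarrow> real"
  assumes "continuous_on {-1..1} F"
  shows "(LINT z|arc_length_measure. F (Re (\<phi> z))) = (LINT z|arc_length_measure. F (Re z))"
  using integral_Re_eqI[OF continuous_\<phi> continuous_on_const continuous_on_id continuous_on_const,
      of 1 1 F] assms norm_\<phi> integral_\<phi>_power by simp

end

section \<open>Secant estimates for even convex functions and the lower bound\<close>

lemma even_convex_mono: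
  fixes \<Phi> :: "real \<Rightarrow> real"
  assumes "convex_on UNIV \<Phi>" "\<And>x. \<Phi> (- x) = \<Phi> x" "0 \<le> x" "x \<le> y"
  shows "\<Phi> x \<le> \<Phi> y"
proof (cases "y = 0")
  case False
  \<comment> \<open>The weight that represents \<open>x\<close> as a convex combination of
    \<open>- y\<close> and \<open>y\<close>.\<close>
  define t where "t = (x / y + 1) / 2"
  have "0 \<le> t" "t \<le> 1"
    using assms False by (auto simp: t_def)
  then have "\<Phi> ((1 - t) *\<^sub>R (- y) + t *\<^sub>R y) \<le> (1 - t) * \<Phi> (- y) + t * \<Phi> y"
    by (intro convex_onD[OF assms(1)]) auto
  moreover have "(1 - t) *\<^sub>R (- y) + t *\<^sub>R y = x"
    using False by (simp add: t_def field_simps)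
  ultimately show ?thesis
    by (simp add: assms(2) algebra_simps)
qed (use assms in auto)

text \<open>Both \<open>x + h\<close> and \<open>y\<close> lie between \<open>x\<close> and
  \<open>y + h\<close>, with the two weights interchanged; the two convexity inequalities add up to
  the claim.\<close>

lemma convex_increment_mono:
  fixes \<Phi> :: "real \<Rightarrow> real"
  assumes "convex_on UNIV \<Phi>" "x \<le> y" "h > 0"
  shows "\<Phi> (x + h) - \<Phi> x \<le> \<Phi> (y + h) - \<Phi> y"
proof -
  define t where "t = h / (y + h - x)"
  have t: "0 \<le> t" "t \<le> 1" and th: "t * (y + h - x) = h"
    using assms by (auto simp: t_def)
  have eq: "(1 - t) *\<^sub>R x + t *\<^sub>R (y + h) = x + h" "(1 - t) *\<^sub>R (y + h) + t *\<^sub>R x = y"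
    using th by (simp_all add: algebra_simps)
  have "\<Phi> (x + h) \<le> (1 - t) * \<Phi> x + t * \<Phi> (y + h)"
    using convex_onD[OF assms(1) t, of x "y + h"] eq by simp
  moreover have "\<Phi> y \<le> (1 - t) * \<Phi> (y + h) + t * \<Phi> x"
    using convex_onD[OF assms(1) t, of "y + h" x] eq by simp
  ultimately show ?thesis
    by (simp add: algebra_simps)
qed

text \<open>Outside the interval from \<open>x\<close> to \<open>x + h\<close> a convex function
  lies above its secant line. Inside it the line exceeds \<open>\<Phi> x\<close> by at most the
  increment \<open>D\<close>, and \<open>\<Phi> x \<le> \<Phi> y\<close> by monotonicity; hence the
  subtraction of \<open>D\<close>.\<close>

lemma even_convex_ge_secant:
  fixes \<Phi> :: "real \<Rightarrow> real"
  assumes \<Phi>: "convex_on UNIV \<Phi>" "\<And>x. \<Phi> (- x) = \<Phi> x" and "0 \<le> x" "0 \<le> y" "h > 0"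
  shows "\<Phi> y \<ge> \<Phi> x + (\<Phi> (x + h) - \<Phi> x) / h * (y - x) - (\<Phi> (x + h) - \<Phi> x)"
proof -
  define D where "D = \<Phi> (x + h) - \<Phi> x"
  have D: "D \<ge> 0"
    unfolding D_def using even_convex_mono[OF \<Phi>, of x "x + h"] assms by simp
  consider "y \<le> x" | "x \<le> y" "y \<le> x + h" | "x + h \<le> y" by linarith
  then have "\<Phi> y \<ge> \<Phi> x + D / h * (y - x) - D"
  proof cases
    case 1
    \<comment> \<open>Here \<open>x\<close> is the intermediate point, a convex combination of
      \<open>x + h\<close> and \<open>y\<close>.\<close>
    define t where "t = h / (x + h - y)"
    have t: "0 \<le> t" "t \<le> 1" and pos: "x + h - y > 0" and th: "t * (x + h - y) = h"
      using assms 1 by (auto simp: t_def)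
    have "(1 - t) *\<^sub>R (x + h) + t *\<^sub>R y = x + h - t * (x + h - y)"
      by (simp add: algebra_simps)
    then have "(1 - t) *\<^sub>R (x + h) + t *\<^sub>R y = x"
      unfolding th by simp
    then have "\<Phi> x \<le> (1 - t) * \<Phi> (x + h) + t * \<Phi> y"
      using convex_onD[OF \<Phi>(1) t, of "x + h" y] by simp
    then have "(x + h - y) * \<Phi> x \<le> (x + h - y) * ((1 - t) * \<Phi> (x + h) + t * \<Phi> y)"
      using pos by (intro mult_left_mono) auto
    also have "\<dots> = (x + h - y - t * (x + h - y)) * \<Phi> (x + h) + t * (x + h - y) * \<Phi> y"
      by (simp add: algebra_simps)
    also have "\<dots> = (x - y) * \<Phi> (x + h) + h * \<Phi> y"
      unfolding th by simp
    finally have "h * \<Phi> x + D * (y - x) \<le> h * \<Phi> y"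
      by (simp add: D_def algebra_simps)
    then have "h * (\<Phi> x + D / h * (y - x)) \<le> h * \<Phi> y"
      using \<open>h > 0\<close> by (simp add: distrib_left)
    then have "\<Phi> x + D / h * (y - x) \<le> \<Phi> y"
      using \<open>h > 0\<close> by simp
    then show ?thesis using D by linarith
  next
    case 2
    have "D / h * (y - x) \<le> D / h * h"
      using 2 D \<open>h > 0\<close> by (intro mult_left_mono) auto
    moreover have "\<Phi> x \<le> \<Phi> y"
      using even_convex_mono[OF \<Phi>] assms 2 by simp
    ultimately show ?thesis using \<open>h > 0\<close> by simp
  next
    case 3
    \<comment> \<open>Here \<open>x + h\<close> is the intermediate point, a convex combination of
      \<open>x\<close> and \<open>y\<close>.\<close>
    define t where "t = h / (y - x)"
    have t: "0 \<le> t" "t \<le> 1" and pos: "y - x > 0" and th: "t * (y - x) = h"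
      using assms 3 by (auto simp: t_def)
    have "(1 - t) *\<^sub>R x + t *\<^sub>R y = x + t * (y - x)"
      by (simp add: algebra_simps)
    then have "(1 - t) *\<^sub>R x + t *\<^sub>R y = x + h"
      unfolding th by simp
    then have "\<Phi> (x + h) \<le> (1 - t) * \<Phi> x + t * \<Phi> y"
      using convex_onD[OF \<Phi>(1) t, of x y] by simp
    then have "(y - x) * \<Phi> (x + h) \<le> (y - x) * ((1 - t) * \<Phi> x + t * \<Phi> y)"
      using pos by (intro mult_left_mono) auto
    also have "\<dots> = (y - x - t * (y - x)) * \<Phi> x + t * (y - x) * \<Phi> y"
      by (simp add: algebra_simps)
    also have "\<dots> = (y - x - h) * \<Phi> x + h * \<Phi> y"
      unfolding th by simp
    finally have "h * \<Phi> x + D * (y - x) \<le> h * \<Phi> y"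
      by (simp add: D_def algebra_simps)
    then have "h * (\<Phi> x + D / h * (y - x)) \<le> h * \<Phi> y"
      using \<open>h > 0\<close> by (simp add: distrib_left)
    then have "\<Phi> x + D / h * (y - x) \<le> \<Phi> y"
      using \<open>h > 0\<close> by simp
    then show ?thesis using D by linarith
  qed
  then show ?thesis by (simp add: D_def)
qed

text \<open>In the application \<open>H (Re (\<phi> z))\<close> is \<open>|Q / A|\<close>, so the
  right-hand integrand is \<Phi> at the modulus of a competitor. The linear term of the secant bound
  integrates to 0 by orthogonality.\<close>

lemma (in blaschke) even_convex_integral_ge:
  fixes \<Phi> H :: "real \<Rightarrow> real"
  assumes \<Phi>: "convex_on UNIV \<Phi>" "\<And>x. \<Phi> (- x) = \<Phi> x"
    and H: "continuous_on {-1..1} H" "\<And>t. t \<in> {-1..1} \<Longrightarrow> H t \<ge> 0"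
  shows "(LINT z|arc_length_measure. \<Phi> (H (Re (\<phi> z)))) \<le>
         (LINT z|arc_length_measure. \<Phi> (H (Re (\<phi> z)) * norm ((\<Prod>k=1..m. z - \<gamma> k) / Q z)))"
    (is "?L \<le> ?R")
proof -
  let ?\<mu> = arc_length_measure
  define \<rho> where "\<rho> z = Re ((\<Prod>k=1..m. z - \<gamma> k) / Q z - 1)" for z
  define x where "x z = H (Re (\<phi> z))" for z
  define y where "y z = x z * norm ((\<Prod>k=1..m. z - \<gamma> k) / Q z)" for z
  define C where "C = (LINT z|?\<mu>. (1::real))"
  obtain M where M: "\<And>t. t \<in> {-1..1} \<Longrightarrow> H t \<le> M"
    using compact_continuous_image[OF H(1) compact_Icc] compact_imp_bounded bounded_real
    by (metis abs_le_D1 imageI)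
  have cont_\<Phi>: "continuous_on S \<Phi>" for S
    using convex_on_continuous[OF open_UNIV \<Phi>(1)] continuous_on_subset by blast
  have Re_\<phi>: "Re (\<phi> z) \<in> {-1..1}" if "z \<in> sphere 0 1" for z
    using norm_\<phi>[of z] abs_Re_le_cmod[of "\<phi> z"] that by auto
  have cont_x: "continuous_on (sphere 0 1) x"
    unfolding x_def
    by (rule continuous_on_compose2[OF H(1)], use Re_\<phi> in \<open>auto intro!: continuous_intros continuous_\<phi>\<close>)
  have cont_\<rho>: "continuous_on (sphere 0 1) \<rho>"
    unfolding \<rho>_def using Q_nonzero by (auto intro!: continuous_intros continuous_Q)
  have cont_y: "continuous_on (sphere 0 1) y"
    unfolding y_def using Q_nonzero by (auto intro!: continuous_intros continuous_Q cont_x)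
  have cont_\<Phi>': "continuous_on S (\<lambda>z. \<Phi> (f z))" if "continuous_on S f" for f :: "'z::topological_space \<Rightarrow> real" and S
    by (rule continuous_on_compose2[OF cont_\<Phi> that subset_UNIV])
  \<comment> \<open>All values of \<open>x\<close> are at most \<open>M\<close>, and increments of
    \<Phi> grow with the base point, so the error of the secant bound is at most \<open>D M\<close>
    uniformly on the circle.\<close>
  have approx: "?L - (\<Phi> (M + h) - \<Phi> M) * C \<le> ?R" if h: "h > 0" for h
  proof -
    define D where "D s = \<Phi> (s + h) - \<Phi> s" for s
    \<comment> \<open>Secant slope times \<open>x\<close>, as a function of \<open>Re \<phi>\<close>
      alone. It is continuous because the slope is a difference quotient of fixed length
      \<open>h\<close>.\<close>
    define F where "F t = D (H t) / h * H t" for t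
    have cont_F: "continuous_on {-1..1} F"
      unfolding F_def D_def using h by (intro continuous_intros cont_\<Phi>' H(1)) auto
    have cont_F_\<phi>: "continuous_on (sphere 0 1) (\<lambda>z. F (Re (\<phi> z)))"
      by (rule continuous_on_compose2[OF cont_F], use Re_\<phi> in \<open>auto intro!: continuous_intros continuous_\<phi>\<close>)
    have "?L - D M * C = (LINT z|?\<mu>. \<Phi> (x z)) + (LINT z|?\<mu>. F (Re (\<phi> z)) * \<rho> z) - (LINT z|?\<mu>. D M * 1)"
      using integral_Re_\<phi>_quotient[OF cont_F, of \<gamma>] by (simp add: x_def \<rho>_def C_def del: minus_complex.sel)
    also have "\<dots> = (LINT z|?\<mu>. \<Phi> (x z) + F (Re (\<phi> z)) * \<rho> z - D M * 1)"
      by (subst Bochner_Integration.integral_diff Bochner_Integration.integral_add,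
          auto intro!: integrable_arc_length continuous_intros cont_\<Phi>' cont_x cont_F_\<phi> cont_\<rho>)+
    also have "\<dots> \<le> (LINT z|?\<mu>. \<Phi> (y z))"
    proof (rule integral_mono)
      fix z assume "z \<in> space ?\<mu>"
      then have z: "z \<in> sphere 0 1" by simp
      then have x: "0 \<le> x z" "x z \<le> M"
        using H(2) M Re_\<phi> by (auto simp: x_def simp del: atLeastAtMost_iff)
      have y: "0 \<le> y z"
        using x by (simp add: y_def)
      \<comment> \<open>This is \<open>Re w \<le> |w|\<close> for the quotient \<open>w\<close> of
        the numerators. The next steps multiply it by \<open>x z\<close> and by the secant slope,
        both nonnegative.\<close>
      have "1 + \<rho> z \<le> norm ((\<Prod>k=1..m. z - \<gamma> k) / Q z)"
        using complex_Re_le_cmod[of "(\<Prod>k=1..m. z - \<gamma> k) / Q z"] by (simp add: \<rho>_def)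
      then have "x z * (1 + \<rho> z) \<le> y z"
        unfolding y_def using x by (intro mult_left_mono)
      then have "x z * \<rho> z \<le> y z - x z"
        by (simp add: algebra_simps)
      moreover have "D (x z) / h \<ge> 0"
        using even_convex_mono[OF \<Phi>, of "x z" "x z + h"] x h by (simp add: D_def)
      ultimately have "D (x z) / h * (x z * \<rho> z) \<le> D (x z) / h * (y z - x z)"
        by (rule mult_left_mono)
      moreover have "\<Phi> (x z) + D (x z) / h * (y z - x z) - D (x z) \<le> \<Phi> (y z)"
        unfolding D_def by (rule even_convex_ge_secant[OF \<Phi> x(1) y h])
      moreover have "D (x z) \<le> D M"
        unfolding D_def by (rule convex_increment_mono[OF \<Phi>(1) x(2) h])
      ultimately show "\<Phi> (x z) + F (Re (\<phi> z)) * \<rho> z - D M * 1 \<le> \<Phi> (y z)"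
        by (simp add: F_def mult.assoc flip: x_def)
    qed (auto intro!: integrable_arc_length continuous_intros cont_\<Phi>' cont_x cont_y cont_F_\<phi> cont_\<rho>)
    finally show ?thesis
      by (simp add: D_def y_def x_def)
  qed
  \<comment> \<open>Along \<open>h = 1 / (k + 1)\<close> the error tends to 0 by continuity of
    \<Phi> at \<open>M\<close>.\<close>
  have "(\<lambda>k. ?L - (\<Phi> (M + inverse (real (Suc k))) - \<Phi> M) * C) \<longlonglongrightarrow> ?L - (\<Phi> (M + 0) - \<Phi> M) * C"
  proof (intro tendsto_intros)
    have "isCont \<Phi> (M + 0)"
      using cont_\<Phi>[of UNIV] by (simp add: continuous_on_eq_continuous_at)
    then show "(\<lambda>k. \<Phi> (M + inverse (real (Suc k)))) \<longlonglongrightarrow> \<Phi> (M + 0)"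
      by (rule isCont_tendsto_compose) (intro tendsto_intros LIMSEQ_inverse_real_of_nat)
  qed
  then have "?L - (\<Phi> (M + 0) - \<Phi> M) * C \<le> ?R"
    by (rule LIMSEQ_le_const2) (intro exI[of _ 0] allI impI approx, simp)
  then show ?thesis by simp
qed

section \<open>The minimum and its value\<close>

theorem theorem2:
  fixes n :: nat and \<alpha> :: "nat \<Rightarrow> complex" and \<Phi> :: "real \<Rightarrow> real"
  assumes "n \<ge> 1"
    and "\<And>k. k \<in> {1..n} \<Longrightarrow> norm (\<alpha> k) > 1"
    and "convex_on UNIV \<Phi>"
    and "\<And>x. \<Phi> (- x) = \<Phi> x"
  shows "\<exists>\<beta>. (\<forall>\<gamma>. Lfun \<Phi> n \<alpha> \<beta> \<le> Lfun \<Phi> n \<alpha> \<gamma>) \<and>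
             Lfun \<Phi> n \<alpha> \<beta> =
               (LINT z|arc_length_measure. \<Phi> (1 / norm (z - complex_of_real (\<Prod>k=1..n. norm (\<alpha> k)))))"
proof -
  define c where "c = - (\<Prod>k=1..n. - \<alpha> k)"
  define a where "a = (\<Prod>k=1..n. norm (\<alpha> k))"
  \<comment> \<open>Chosen unimodular with \<open>cnj u * a = c\<close>, which rotates the complex
    constant \<open>c\<close> to the positive real \<open>a\<close>.\<close>
  define u where "u = cnj c / of_real a"
  define K where "K = complex_of_real (1 - norm c ^ 2)"
  define A where "A z = (\<Prod>k=1..n. z - \<alpha> k)" for z
  obtain \<beta> where \<beta>: "\<And>k. k \<in> {1..n-1} \<Longrightarrow> norm (\<beta> k) < 1"
    and num: "\<And>z. z * (\<Prod>k=1..n-1. z - \<beta> k) * K = A z + c * (\<Prod>k=1..n. 1 - cnj (\<alpha> k) * z)"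
    unfolding K_def A_def c_def
    using extremal_numerator_exists[of n \<alpha>, OF assms(1,2)] by blast
  have a: "a > 1"
    unfolding a_def using assms(1,2) by (intro less_1_prod) auto
  have norm_c: "norm c = a"
    by (simp add: c_def a_def flip: prod_norm)
  then have norm_u: "norm u = 1"
    using a by (simp add: u_def norm_divide)
  have u: "cnj u * u = 1" "cnj u * of_real a = c"
    using complex_norm_square[of u] norm_u a by (simp_all add: mult.commute) (simp add: u_def)
  have K: "K \<noteq> 0" "K = 1 - c * cnj c"
  proof -
    have "1 < a ^ 2"
      using a by (simp add: one_less_power)
    then show "K \<noteq> 0"
      unfolding K_def of_real_eq_0_iff norm_c by simp
    show "K = 1 - c * cnj c"
      by (simp add: K_def flip: complex_norm_square)
  qed
  interpret blaschke u "n - 1" \<beta>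
    using \<beta> norm_u by unfold_locales auto
  have A_nonzero: "A z \<noteq> 0" if "norm z = 1" for z
    using assms(2) that by (fastforce simp: A_def)
  \<comment> \<open>Conjugating the identity that defines \<open>Q\<close> and multiplying by
    \<open>z ^ n\<close> gives a second relation between \<open>A\<close> and its reflection.
    Eliminating the reflection leaves \<open>A\<close> times \<open>1 - c * cnj c\<close>, that is,
    \<open>A * K\<close>.\<close>
  have A_eq: "A z = z * Q z - c * Qstar z" if z: "norm z = 1" for z
  proof -
    have zz: "z * cnj z = 1"
      using complex_norm_square[of z] z by simp
    have zn: "z ^ n * cnj z ^ n = 1"
      using zz by (metis power_mult_distrib power_one)
    have zn': "z ^ n * cnj z = z ^ (n - 1)"
      using zz assms(1) by (cases n) (simp_all add: mult_ac)
    have num': "z * Q z * K = A z + c * (z ^ n * cnj (A z))"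
      using num[of z] prod_reflect_cnj[OF z, of \<alpha> "{1..n}"] unfolding Q_def A_def by simp
    have "cnj K = K"
      by (simp add: K_def)
    then have "Qstar z * K = z ^ n * cnj (z * Q z * K)"
      unfolding Qstar_eq[OF z] zn'[symmetric] by (simp only: complex_cnj_mult mult_ac)
    also have "\<dots> = z ^ n * cnj (A z) + cnj c * (z ^ n * cnj z ^ n) * A z"
      unfolding num' by (simp add: algebra_simps)
    finally have star: "Qstar z * K = z ^ n * cnj (A z) + cnj c * A z"
      unfolding zn by simp
    have "(z * Q z - c * Qstar z) * K = z * Q z * K - c * (Qstar z * K)"
      by (simp add: left_diff_distrib)
    also have "\<dots> = A z * K"
      unfolding num' star unfolding K(2) by (simp add: algebra_simps)
    finally have "(z * Q z - c * Qstar z) * K = A z * K" .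
    then show ?thesis
      using K(1) by simp
  qed
  \<comment> \<open>By the law of cosines \<open>|w - a|\<^sup>2 = 1 - 2 a Re w + a\<^sup>2\<close>
    for \<open>|w| = 1\<close>, so \<open>H (Re w)\<close> is \<open>1 / |w - a|\<close>. Thus the
    target integrand depends on \<open>Re w\<close> only.\<close>
  define H where "H t = 1 / sqrt (1 - 2 * a * t + a ^ 2)" for t
  have H_pos: "1 - 2 * a * t + a ^ 2 > 0" if "t \<in> {-1..1}" for t
  proof -
    have "0 < (a - 1) ^ 2"
      using a by simp
    also have "\<dots> \<le> 1 - 2 * a * t + a ^ 2"
      using that a by (simp add: power2_eq_square algebra_simps)
    finally show ?thesis .
  qed
  have H: "continuous_on {-1..1} H" "\<And>t. t \<in> {-1..1} \<Longrightarrow> H t \<ge> 0"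
    unfolding H_def using H_pos by (fastforce intro!: continuous_intros, fastforce intro: less_imp_le)
  have H_eq: "H (Re w) = 1 / norm (w - of_real a)" if "norm w = 1" for w
  proof -
    have "(Re w)\<^sup>2 + (Im w)\<^sup>2 = 1"
      using that by (simp flip: cmod_power2)
    then have "(Re w - a)\<^sup>2 + (Im w)\<^sup>2 = 1 - 2 * a * Re w + a ^ 2"
      by (simp add: power2_eq_square algebra_simps)
    then show ?thesis
      by (simp add: H_def norm_complex_def)
  qed
  have norm_quotient: "norm (Q z / A z) = H (Re (\<phi> z))" if z: "norm z = 1" for z
  proof -
    have "\<phi> z * Qstar z = u * z * Q z"
      using z by (intro \<phi>_mult_Qstar) simp
    then have "cnj u * Qstar z * (\<phi> z - of_real a) = cnj u * u * (z * Q z) - cnj u * of_real a * Qstar z"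
      by (simp add: algebra_simps)
    \<comment> \<open>In this factorization \<open>cnj u\<close> is unimodular and
      \<open>|Qstar| = |Q|\<close> on the circle, so \<open>|Q / A|\<close> reduces to
      \<open>1 / |\<phi> - a|\<close>.\<close>
    then have "A z = cnj u * Qstar z * (\<phi> z - of_real a)"
      unfolding u using A_eq[OF z] by simp
    then show ?thesis
      using norm_u Q_nonzero[OF z]
      unfolding H_eq[OF norm_\<phi>[OF z]] by (simp add: norm_divide norm_mult norm_Qstar[OF z] del: One_nat_def)
  qed
  have Lfun_\<beta>: "Lfun \<Phi> n \<alpha> \<beta> = (LINT z|arc_length_measure. \<Phi> (H (Re (\<phi> z))))"
    unfolding Lfun_def Pfun_def
  proof (rule Bochner_Integration.integral_cong[OF refl])
    fix z assume "z \<in> space arc_length_measure"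
    then have z: "norm z = 1" by simp
    show "\<Phi> (norm ((\<Prod>k=1..n-1. z - \<beta> k) / (\<Prod>k=1..n. z - \<alpha> k))) = \<Phi> (H (Re (\<phi> z)))"
      unfolding norm_quotient[OF z, symmetric] Q_def A_def by (rule refl)
  qed
  have Lfun_\<gamma>: "Lfun \<Phi> n \<alpha> \<gamma> =
      (LINT z|arc_length_measure. \<Phi> (H (Re (\<phi> z)) * norm ((\<Prod>k=1..n-1. z - \<gamma> k) / Q z)))" for \<gamma>
    unfolding Lfun_def Pfun_def
  proof (rule Bochner_Integration.integral_cong[OF refl])
    fix z assume "z \<in> space arc_length_measure"
    then have z: "norm z = 1" by simp
    show "\<Phi> (norm ((\<Prod>k=1..n-1. z - \<gamma> k) / (\<Prod>k=1..n. z - \<alpha> k))) =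
        \<Phi> (H (Re (\<phi> z)) * norm ((\<Prod>k=1..n-1. z - \<gamma> k) / Q z))"
      using Q_nonzero[OF z] unfolding A_def[symmetric] norm_quotient[OF z, symmetric]
      by (simp add: norm_divide del: One_nat_def)
  qed
  have "continuous_on UNIV \<Phi>"
    by (rule convex_on_continuous[OF open_UNIV assms(3)])
  then have "continuous_on {-1..1} (\<lambda>t. \<Phi> (H t))"
    by (rule continuous_on_compose2[OF _ H(1)]) simp
  then have "Lfun \<Phi> n \<alpha> \<beta> = (LINT z|arc_length_measure. \<Phi> (H (Re z)))"
    unfolding Lfun_\<beta> by (rule integral_Re_\<phi>)
  also have "\<dots> = (LINT z|arc_length_measure. \<Phi> (1 / norm (z - complex_of_real a)))"
    by (rule Bochner_Integration.integral_cong[OF refl]) (simp add: H_eq)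
  finally have min_eq: "Lfun \<Phi> n \<alpha> \<beta> = (LINT z|arc_length_measure. \<Phi> (1 / norm (z - complex_of_real a)))" .
  have "Lfun \<Phi> n \<alpha> \<beta> \<le> Lfun \<Phi> n \<alpha> \<gamma>" for \<gamma>
    unfolding Lfun_\<beta> unfolding Lfun_\<gamma> by (rule even_convex_integral_ge[OF assms(3,4) H])
  with min_eq show ?thesis
    unfolding a_def by blast
qed

end
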